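(* Let $K$ be a closed subgroup of $O(n)$ with complexification $K_{\mathbb{C}}\subset O(n;\mathbb{C})$. Suppose that $K$ is transitive on the spheres about $0$ in $\mathbb{R}^n$. Then the categorical quotient satisfies $\mathbb{C}^n/\!/K_{\mathbb{C}}\cong\mathbb{C}$, where the isomorphism is given by $Q_c\mapsto c$ for $c\neq 0$ and $Q_0\cup\{0\}\mapsto 0$.
   Context: $b$ is the $\mathbb{C}$-bilinear form on $\mathbb{C}^n$ extending the standard inner product of $\mathbb{R}^n$. For $0\ne c\in\mathbb{C}$, $Q_c=\{\xi\in\mathbb{C}^n\mid b(\xi,\xi)=c\}$, and $Q_0=\{\xi\in\mathbb{C}^n\mid b(\xi,\xi)=0,\ \xi\neq 0\}$. Complexification: with $\mathfrak{k}$ the Lie algebra of $K$, $K_{\mathbb{C}}^0$ is the analytic subgroup of $GL(n;\mathbb{C})$ with Lie algebra $\mathfrak{k}\otimes_{\mathbb{R}}\mathbb{C}$, and $K_{\mathbb{C}}:=K K_{\mathbb{C}}^0$, a closed complex subgroup of $O(n;\mathbb{C})$. Categorical quotient: $\mathbb{C}^n/\!/K_{\mathbb{C}}$ is the set of equivalence classes for $\xi\sim\xi'$ iff $p(\xi)=p(\xi')$ for all $K_{\mathbb{C}}$-invariant polynomials $p$ on $\mathbb{C}^n$, with the structure of affine variety whose algebra of regular functions is the algebra of $K_{\mathbb{C}}$-invariant polynomials. The isomorphism is one of affine varieties; the theorem says in particular that the equivalence classes are the sets $Q_c$ ($c\ne0$) and $Q_0\cup\{0\}$. *)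

theory Defs
  imports "HOL-Analysis.Analysis" "HOL-Algebra.Generated_Groups"
begin

section \<open>The bilinear form and its level sets\<close>

definition bform :: "complex^'n \<Rightarrow> complex^'n \<Rightarrow> complex" where
  "bform \<xi> \<eta> = (\<Sum>i\<in>UNIV. \<xi> $ i * \<eta> $ i)"

definition Q :: "complex \<Rightarrow> (complex^'n) set" where
  "Q c = (if c = 0 then {\<xi>. bform \<xi> \<xi> = 0 \<and> \<xi> \<noteq> 0} else {\<xi>. bform \<xi> \<xi> = c})"


section \<open>Matrix groups and complexification\<close>

definition general_linear :: "('a::field^'n^'n) monoid" where
  "general_linear = \<lparr>carrier = {A. invertible A}, mult = (\<lambda>A B. A ** B), one = mat 1\<rparr>"

definition orthogonal_grp :: "(real^'n^'n) monoid" where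
  "orthogonal_grp = \<lparr>carrier = {A. orthogonal_matrix A}, mult = (\<lambda>A B. A ** B), one = mat 1\<rparr>"

definition transitive_on_spheres :: "(real^'n^'n) set \<Rightarrow> bool" where
  "transitive_on_spheres K \<longleftrightarrow>
     (\<forall>r>0. \<forall>x\<in>sphere 0 r. \<forall>y\<in>sphere 0 r. \<exists>k\<in>K. k *v x = y)"

text \<open>The type \<^typ>\<open>'a^'n^'n\<close> carries no ring structure, so the power series of the
  matrix exponential is written with iterated matrix multiplication.\<close>

definition mexp :: "'a::real_normed_algebra_1^'n^'n \<Rightarrow> 'a^'n^'n" where
  "mexp A = suminf (\<lambda>k. (1 / fact k) *\<^sub>R ((\<lambda>B. A ** B) ^^ k) (mat 1))"

text \<open>For closed linear groups this agrees with the tangent space at the identity.\<close>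

definition lie_algebra :: "(real^'n^'n) set \<Rightarrow> (real^'n^'n) set" where
  "lie_algebra K = {X. \<forall>t::real. mexp (t *\<^sub>R X) \<in> K}"

text \<open>Since real matrices X and Y are determined by X + iY, the tensor product of a real space
  of real matrices with the complex numbers is its complex span inside the complex matrices.\<close>

definition lie_algebra_complexification :: "(real^'n^'n) set \<Rightarrow> (complex^'n^'n) set" where
  "lie_algebra_complexification L =
     {map_matrix complex_of_real X + map_matrix (\<lambda>y. \<i> * complex_of_real y) Y |X Y. X \<in> L \<and> Y \<in> L}"

text \<open>The analytic (that is, connected Lie) subgroup with a given Lie algebra is the subgroup
  of the general linear group generated by the exponentials of that Lie algebra.\<close>

definition analytic_subgroup :: "(complex^'n^'n) set \<Rightarrow> (complex^'n^'n) set" where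
  "analytic_subgroup L = generate general_linear (mexp ` L)"

definition complexification :: "(real^'n^'n) set \<Rightarrow> (complex^'n^'n) set" where
  "complexification K =
     (map_matrix complex_of_real ` K) <#>\<^bsub>general_linear\<^esub>
     analytic_subgroup (lie_algebra_complexification (lie_algebra K))"


section \<open>Affine varieties over the complex numbers\<close>

text \<open>A space with functions: a set of points together with an algebra of complex-valued
  functions on it. Functions are kept extensional, i.e. \<^term>\<open>undefined\<close> off the point set,
  so that equal functions on the points are equal.\<close>

record 'a space_with_functions =
  points :: "'a set"
  regular :: "('a \<Rightarrow> complex) set"

inductive_set generated_subalgebra :: "'a set \<Rightarrow> ('a \<Rightarrow> complex) set \<Rightarrow> ('a \<Rightarrow> complex) set"
  for X F where
  gen: "f \<in> F \<Longrightarrow> f \<in> generated_subalgebra X F"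
| const: "(\<lambda>x\<in>X. c) \<in> generated_subalgebra X F"
| add: "f \<in> generated_subalgebra X F \<Longrightarrow> g \<in> generated_subalgebra X F
        \<Longrightarrow> (\<lambda>x\<in>X. f x + g x) \<in> generated_subalgebra X F"
| mult: "f \<in> generated_subalgebra X F \<Longrightarrow> g \<in> generated_subalgebra X F
        \<Longrightarrow> (\<lambda>x\<in>X. f x * g x) \<in> generated_subalgebra X F"

text \<open>Unital algebra homomorphisms from a function algebra on \<^term>\<open>X\<close> to the complex numbers.
  Compatibility with scalars is the condition on constants.\<close>

definition character_on :: "'a set \<Rightarrow> ('a \<Rightarrow> complex) set \<Rightarrow> (('a \<Rightarrow> complex) \<Rightarrow> complex) \<Rightarrow> bool" where
  "character_on X A \<psi> \<longleftrightarrow>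
     (\<forall>c. \<psi> (\<lambda>x\<in>X. c) = c) \<and>
     (\<forall>f\<in>A. \<forall>g\<in>A. \<psi> (\<lambda>x\<in>X. f x + g x) = \<psi> f + \<psi> g \<and> \<psi> (\<lambda>x\<in>X. f x * g x) = \<psi> f * \<psi> g)"

text \<open>A (classical, hence reduced) affine variety: the regular functions form a finitely generated
  algebra of functions, and the points are exactly its characters via evaluation.\<close>

definition affine_variety :: "'a space_with_functions \<Rightarrow> bool" where
  "affine_variety V \<longleftrightarrow>
     regular V \<subseteq> extensional (points V) \<and>
     (\<exists>F. finite F \<and> F \<subseteq> regular V \<and> regular V = generated_subalgebra (points V) F) \<and>
     (\<forall>\<psi>. character_on (points V) (regular V) \<psi> \<longrightarrow>
        (\<exists>!x. x \<in> points V \<and> (\<forall>f\<in>regular V. \<psi> f = f x)))"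

definition variety_morphism ::
    "'a space_with_functions \<Rightarrow> 'b space_with_functions \<Rightarrow> ('a \<Rightarrow> 'b) \<Rightarrow> bool" where
  "variety_morphism V W \<phi> \<longleftrightarrow>
     \<phi> \<in> points V \<rightarrow> points W \<and>
     (\<forall>f\<in>regular W. (\<lambda>x\<in>points V. f (\<phi> x)) \<in> regular V)"

definition affine_variety_iso ::
    "'a space_with_functions \<Rightarrow> 'b space_with_functions \<Rightarrow> ('a \<Rightarrow> 'b) \<Rightarrow> bool" where
  "affine_variety_iso V W \<phi> \<longleftrightarrow>
     affine_variety V \<and> affine_variety W \<and> bij_betw \<phi> (points V) (points W) \<and>
     variety_morphism V W \<phi> \<and> variety_morphism W V (inv_into (points V) \<phi>)"

definition affine_line :: "complex space_with_functions" where
  "affine_line = \<lparr>points = UNIV, regular = range poly\<rparr>"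


section \<open>The categorical quotient\<close>

text \<open>Polynomials on complex n-space as finite sums of monomials, indexed by a finite set of
  exponent vectors.\<close>

definition polynomial_fun :: "(complex^'n \<Rightarrow> complex) \<Rightarrow> bool" where
  "polynomial_fun p \<longleftrightarrow>
     (\<exists>(S :: ('n \<Rightarrow> nat) set) a. finite S \<and>
        p = (\<lambda>\<xi>. \<Sum>\<alpha>\<in>S. a \<alpha> * (\<Prod>i\<in>UNIV. \<xi> $ i ^ \<alpha> i)))"

definition invariant_polynomials :: "(complex^'n^'n) set \<Rightarrow> (complex^'n \<Rightarrow> complex) set" where
  "invariant_polynomials G = {p. polynomial_fun p \<and> (\<forall>g\<in>G. \<forall>\<xi>. p (g *v \<xi>) = p \<xi>)}"

definition invariant_rel :: "(complex^'n^'n) set \<Rightarrow> (complex^'n) rel" where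
  "invariant_rel G = {(\<xi>, \<eta>). \<forall>p\<in>invariant_polynomials G. p \<xi> = p \<eta>}"

text \<open>A function on the set of classes is regular iff its pullback along the quotient map
  is an invariant polynomial.\<close>

definition categorical_quotient :: "(complex^'n^'n) set \<Rightarrow> (complex^'n) set space_with_functions" where
  "categorical_quotient G =
     \<lparr>points = UNIV // invariant_rel G,
      regular = {f \<in> extensional (UNIV // invariant_rel G).
                   (\<lambda>\<xi>. f (invariant_rel G `` {\<xi>})) \<in> invariant_polynomials G}\<rparr>"

end

theory Submission
  imports Defs
begin

text \<open>The complexification is generated by orthogonal matrices and exponentials of complex skew
  matrices, so it preserves the form b. Conversely, a K-invariant polynomial restricted to the real
  vectors depends only on the norm, so along a real line through 0 it is an even polynomial
  in one variable, that is, a polynomial in the square of the norm. As real vectors are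
  Zariski dense, the invariant polynomial is a polynomial in b(\<xi>,\<xi>). The quotient is therefore
  the image of \<xi> \<mapsto> b(\<xi>,\<xi>), which is surjective.\<close>

section \<open>The matrix exponential\<close>

abbreviation matpow :: "'a::real_normed_algebra_1^'n^'n \<Rightarrow> nat \<Rightarrow> 'a^'n^'n" where
  "matpow A k \<equiv> ((\<lambda>B. A ** B) ^^ k) (mat 1)"

text \<open>The total of all entry norms dominates every row sum, so one more factor
  \<open>A\<close> costs at most one more factor of that total. The bound is crude but uniform in
  the entries.\<close>

lemma norm_matpow_nth_le:
  fixes A :: "'a::real_normed_field^'n^'n"
  shows "norm (matpow A k $ i $ j) \<le> (\<Sum>l\<in>UNIV. \<Sum>m\<in>UNIV. norm (A $ l $ m)) ^ k"
proof (induction k arbitrary: i)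
  case 0
  then show ?case by (simp add: mat_def)
next
  case (Suc k)
  let ?M = "\<Sum>l\<in>UNIV. \<Sum>m\<in>UNIV. norm (A $ l $ m)"
  have "norm (matpow A (Suc k) $ i $ j) \<le> (\<Sum>m\<in>UNIV. norm (A $ i $ m * matpow A k $ m $ j))"
    by (simp add: matrix_matrix_mult_def norm_sum)
  also have "\<dots> \<le> (\<Sum>m\<in>UNIV. norm (A $ i $ m) * ?M ^ k)"
    unfolding norm_mult by (intro sum_mono mult_left_mono Suc.IH norm_ge_zero)
  also have "\<dots> = (\<Sum>m\<in>UNIV. norm (A $ i $ m)) * ?M ^ k"
    by (simp add: sum_distrib_right)
  also have "\<dots> \<le> ?M * ?M ^ k"
    by (intro mult_right_mono member_le_sum[of i UNIV "\<lambda>i. \<Sum>m\<in>UNIV. norm (A $ i $ m)"]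
        zero_le_power sum_nonneg) auto
  finally show ?case by simp
qed

text \<open>Comparison with the scalar exponential series at the entry total times
  \<open>norm t\<close>. Convergence for every \<open>t\<close> is what permits termwise
  differentiation.\<close>

lemma summable_mexp_nth:
  fixes A :: "'a::{real_normed_field,banach}^'n^'n"
  shows "summable (\<lambda>k. matpow A k $ i $ j / fact k * t ^ k)"
proof (rule summable_comparison_test')
  let ?M = "\<Sum>l\<in>UNIV. \<Sum>m\<in>UNIV. norm (A $ l $ m)"
  show "summable (\<lambda>k. inverse (fact k) * (?M * norm t) ^ k)"
    by (rule summable_exp)
  fix k
  have "norm (matpow A k $ i $ j) * norm t ^ k / fact k \<le> ?M ^ k * norm t ^ k / fact k"
    by (intro divide_right_mono mult_right_mono norm_matpow_nth_le) auto
  then show "norm (matpow A k $ i $ j / fact k * t ^ k) \<le> inverse (fact k) * (?M * norm t) ^ k"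
    by (simp add: norm_mult norm_divide norm_power power_mult_distrib field_simps)
qed

lemma sums_matrixI:
  fixes f :: "nat \<Rightarrow> 'a::real_normed_vector^'n^'m"
  assumes "\<And>i j. (\<lambda>k. f k $ i $ j) sums (s $ i $ j)"
  shows "f sums s"
  using assms unfolding sums_def by (intro vec_tendstoI) simp

lemma matpow_scale:
  fixes A :: "'a::real_normed_field^'n^'n"
  shows "matpow (map_matrix ((*) t) A) k $ i $ j = t ^ k * matpow A k $ i $ j"
  by (induction k arbitrary: i)
     (auto simp: matrix_matrix_mult_def sum_distrib_left mult_ac intro!: sum.cong)

text \<open>Convergence of matrices is entrywise, so each entry of the exponential is an everywhere
  convergent power series in \<open>t\<close>. The parameter lies in the field of the entries, which
  allows complex derivatives.\<close>

lemma mexp_scale_nth: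
  fixes A :: "'a::{real_normed_field,banach}^'n^'n"
  shows "mexp (map_matrix ((*) t) A) $ i $ j = (\<Sum>k. matpow A k $ i $ j / fact k * t ^ k)"
proof -
  define S where "S = (\<chi> i j. \<Sum>k. matpow A k $ i $ j / fact k * t ^ k)"
  have "(\<lambda>k. (1 / fact k) *\<^sub>R matpow (map_matrix ((*) t) A) k) sums S"
  proof (rule sums_matrixI)
    fix i j
    have "(\<lambda>k. ((1 / fact k) *\<^sub>R matpow (map_matrix ((*) t) A) k) $ i $ j) =
          (\<lambda>k. matpow A k $ i $ j / fact k * t ^ k)"
      by (rule ext) (simp add: matpow_scale, simp add: scaleR_conv_of_real of_real_inverse field_simps)
    then show "(\<lambda>k. ((1 / fact k) *\<^sub>R matpow (map_matrix ((*) t) A) k) $ i $ j) sums (S $ i $ j)"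
      using summable_sums[OF summable_mexp_nth[of A i j t]] by (simp add: S_def)
  qed
  then have "mexp (map_matrix ((*) t) A) = S"
    by (simp add: mexp_def sums_iff)
  then show ?thesis by (simp add: S_def)
qed

lemma mexp_scale_0:
  fixes A :: "'a::{real_normed_field,banach}^'n^'n"
  shows "mexp (map_matrix ((*) 0) A) = mat 1"
proof -
  have "mexp (map_matrix ((*) 0) A) $ i $ j = mat 1 $ i $ j" for i j
    using powser_zero[of "\<lambda>k. matpow A k $ i $ j / fact k"]
    by (simp add: mexp_scale_nth)
  then show ?thesis by (simp add: vec_eq_iff)
qed

lemma mexp_scale_nth_deriv:
  fixes A :: "'a::{real_normed_field,banach}^'n^'n"
  shows "((\<lambda>t. mexp (map_matrix ((*) t) A) $ i $ j) has_field_derivative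
          (A ** mexp (map_matrix ((*) t) A)) $ i $ j) (at t)"
proof -
  let ?c = "\<lambda>k. matpow A k $ i $ j / fact k"
  \<comment> \<open>The factor \<open>Suc k\<close> in \<open>diffs\<close> cancels against the
    factorial, and the extra matrix factor of the next power comes out in front. Summing gives E' =
    A E.\<close>
  have "diffs ?c k * t ^ k = (\<Sum>l\<in>UNIV. A $ i $ l * (matpow A k $ l $ j / fact k * t ^ k))" for k
  proof -
    have "diffs ?c k = (A ** matpow A k) $ i $ j / fact k"
      by (simp add: diffs_def del: of_nat_Suc)
    also have "\<dots> = (\<Sum>l\<in>UNIV. A $ i $ l * matpow A k $ l $ j) / fact k"
      by (simp add: matrix_matrix_mult_def)
    finally show ?thesis
      by (simp add: sum_distrib_left sum_distrib_right sum_divide_distrib mult_ac)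
  qed
  moreover have "(\<lambda>k. \<Sum>l\<in>UNIV. A $ i $ l * (matpow A k $ l $ j / fact k * t ^ k)) sums
      (\<Sum>l\<in>UNIV. A $ i $ l * mexp (map_matrix ((*) t) A) $ l $ j)"
    unfolding mexp_scale_nth by (intro sums_sum sums_mult summable_sums summable_mexp_nth)
  ultimately have "(\<Sum>k. diffs ?c k * t ^ k) = (A ** mexp (map_matrix ((*) t) A)) $ i $ j"
    by (simp add: sums_iff matrix_matrix_mult_def)
  moreover have "((\<lambda>t. \<Sum>k. ?c k * t ^ k) has_field_derivative (\<Sum>k. diffs ?c k * t ^ k)) (at t)"
    by (intro termdiffs_strong_converges_everywhere summable_mexp_nth)
  ultimately show ?thesis
    by (simp only: mexp_scale_nth)
qed

section \<open>The Gram matrix along a one-parameter group\<close>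

lemma matrix_add_rdistrib: "((A + B) ** C) = (A ** C) + (B ** C)"
  by (simp add: matrix_matrix_mult_def vec_eq_iff sum.distrib distrib_right)

text \<open>Product rule together with E' = A E. The formula serves in both directions: a skew
  \<open>A\<close> makes the Gram matrix constant, and a constant Gram matrix forces
  \<open>A\<close> to be skew.\<close>

lemma mexp_gram_deriv:
  fixes A :: "'a::{real_normed_field,banach}^'n^'n"
  defines "E \<equiv> \<lambda>t. mexp (map_matrix ((*) t) A)"
  shows "((\<lambda>t. (transpose (E t) ** E t) $ i $ j) has_field_derivative
          (transpose (E t) ** ((transpose A + A) ** E t)) $ i $ j) (at t)"
proof -
  have "((\<lambda>t. \<Sum>l\<in>UNIV. E t $ l $ i * E t $ l $ j) has_field_derivative
      (\<Sum>l\<in>UNIV. (A ** E t) $ l $ i * E t $ l $ j + (A ** E t) $ l $ j * E t $ l $ i)) (at t)"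
    unfolding E_def by (intro DERIV_sum DERIV_mult mexp_scale_nth_deriv)
  moreover have "(\<Sum>l\<in>UNIV. (A ** E t) $ l $ i * E t $ l $ j + (A ** E t) $ l $ j * E t $ l $ i)
      = (transpose (A ** E t) ** E t + transpose (E t) ** (A ** E t)) $ i $ j"
    by (simp add: matrix_matrix_mult_def transpose_def sum.distrib mult_ac)
  moreover have "transpose (A ** E t) ** E t + transpose (E t) ** (A ** E t)
      = transpose (E t) ** ((transpose A + A) ** E t)"
    by (simp add: matrix_transpose_mul matrix_mul_assoc matrix_add_ldistrib matrix_add_rdistrib)
  moreover have "(\<Sum>l\<in>UNIV. E t $ l $ i * E t $ l $ j) = (transpose (E t) ** E t) $ i $ j" for t
    by (simp add: matrix_matrix_mult_def transpose_def)
  ultimately show ?thesis by (simp only:)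
qed

text \<open>The Gram matrix has derivative 0, hence its value at t = 1 is its value at t = 0, the
  identity. The transpose is taken without conjugation, so complex skew matrices are
  covered.\<close>

lemma mexp_skew_orthogonal:
  fixes A :: "'a::{real_normed_field,banach}^'n^'n"
  assumes "transpose A + A = 0"
  shows "transpose (mexp A) ** mexp A = mat 1"
proof -
  let ?E = "\<lambda>t. mexp (map_matrix ((*) t) A)"
  have "(transpose (?E 1) ** ?E 1) $ i $ j = (transpose (?E 0) ** ?E 0) $ i $ j" for i j
  proof -
    have "((\<lambda>t. (transpose (?E t) ** ?E t) $ i $ j) has_field_derivative 0) (at t within UNIV)" for t
      using mexp_gram_deriv[of A i j t] assms by simp
    from has_field_derivative_zero_constant[OF convex_UNIV this] show ?thesis by auto
  qed
  moreover have "map_matrix ((*) 1) A = A" by (simp add: vec_eq_iff)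
  ultimately show ?thesis by (simp add: mexp_scale_0 vec_eq_iff transpose_mat)
qed

lemma lie_algebra_orthogonal_skew:
  assumes "K \<subseteq> {A. orthogonal_matrix A}" and "X \<in> lie_algebra K"
  shows "transpose X + X = 0"
proof -
  let ?E = "\<lambda>t. mexp (map_matrix ((*) t) X)"
  have "t *\<^sub>R X = map_matrix ((*) t) X" for t
    by (simp add: vec_eq_iff)
  then have orth: "transpose (?E t) ** ?E t = mat 1" for t
    using assms by (auto simp: lie_algebra_def orthogonal_matrix)
  \<comment> \<open>At t = 0 the exponential is the identity, so the derivative formula reduces to
    this entry; by \<open>orth\<close> the differentiated function is constant.\<close>
  have "(transpose X + X) $ i $ j = 0" for i j
    using mexp_gram_deriv[of X i j 0] DERIV_unique[OF DERIV_const]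
    by (fastforce simp: orth mexp_scale_0 transpose_mat)
  then show ?thesis by (simp add: vec_eq_iff)
qed


section \<open>The complexification is contained in the complex orthogonal group\<close>

lemma group_general_linear: "group (general_linear :: ('a::field^'n^'n) monoid)"
proof (rule groupI)
  show "\<exists>B\<in>carrier general_linear. B \<otimes>\<^bsub>general_linear\<^esub> A = \<one>\<^bsub>general_linear\<^esub>"
    if "A \<in> carrier general_linear" for A :: "'a^'n^'n"
    using that by (auto simp: general_linear_def invertible_def)
next
  show "\<one>\<^bsub>general_linear\<^esub> \<in> carrier (general_linear :: ('a^'n^'n) monoid)"
    by (auto simp: general_linear_def invertible_def intro: exI[of _ "mat 1"])
qed (auto simp: general_linear_def invertible_mult matrix_mul_assoc)

lemma generate_general_linear_orthogonal:
  fixes H :: "('a::field^'n^'n) set"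
  assumes H: "\<And>h. h \<in> H \<Longrightarrow> transpose h ** h = mat 1" and "g \<in> generate general_linear H"
  shows "transpose g ** g = mat 1"
  using assms(2)
proof induction
  case one
  then show ?case by (simp add: general_linear_def transpose_mat)
next
  case (incl h)
  then show ?case by (rule H)
next
  case (inv h)
  interpret group "general_linear :: ('a^'n^'n) monoid" by (rule group_general_linear)
  \<comment> \<open>For square matrices a left inverse is also a right inverse, so the group inverse
    of \<open>h\<close> is its transpose.\<close>
  have h: "transpose h ** h = mat 1" "h ** transpose h = mat 1"
    using H[OF inv] by (auto simp: matrix_left_right_inverse)
  then have "inv\<^bsub>general_linear\<^esub> h = transpose h"
    by (intro inv_equality) (auto simp: general_linear_def invertible_def)
  with h show ?case by simp
next
  case (eng g h)
  have "transpose (g ** h) ** (g ** h) = transpose h ** (transpose g ** g) ** h"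
    by (simp only: matrix_transpose_mul matrix_mul_assoc)
  with eng show ?case by (simp add: general_linear_def)
qed

text \<open>An element is a real orthogonal matrix times a product of exponentials of X + iY and
  their inverses. Since X and Y are skew, so is X + iY, and each factor satisfies the
  relation.\<close>

lemma complexification_orthogonal:
  assumes "K \<subseteq> {A. orthogonal_matrix A}" and "g \<in> complexification K"
  shows "transpose g ** g = mat 1"
proof -
  obtain k h where k: "k \<in> K" and g: "g = map_matrix complex_of_real k ** h"
    and h: "h \<in> analytic_subgroup (lie_algebra_complexification (lie_algebra K))"
    using assms(2) by (auto simp: complexification_def set_mult_def general_linear_def)
  have "transpose (mexp Z) ** mexp Z = mat 1"
    if Z_in: "Z \<in> lie_algebra_complexification (lie_algebra K)" for Z
  proof -
    obtain X Y where XY: "X \<in> lie_algebra K" "Y \<in> lie_algebra K"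
      and Z: "Z = map_matrix complex_of_real X + map_matrix (\<lambda>y. \<i> * complex_of_real y) Y"
      using Z_in unfolding lie_algebra_complexification_def by blast
    have skew: "X $ j $ i + X $ i $ j = 0" "Y $ j $ i + Y $ i $ j = 0" for i j
      using XY[THEN lie_algebra_orthogonal_skew[OF assms(1)]]
      by (simp_all add: vec_eq_iff transpose_def)
    have "(transpose Z + Z) $ i $ j =
        complex_of_real (X $ j $ i + X $ i $ j) + \<i> * complex_of_real (Y $ j $ i + Y $ i $ j)" for i j
      by (simp add: Z transpose_def algebra_simps)
    then have "transpose Z + Z = 0"
      by (simp only: skew vec_eq_iff) simp
    then show ?thesis by (rule mexp_skew_orthogonal)
  qed
  then have "transpose h ** h = mat 1"
    by (intro generate_general_linear_orthogonal[OF _ h[unfolded analytic_subgroup_def]]) blast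
  moreover have "transpose (map_matrix complex_of_real k) ** map_matrix complex_of_real k = mat 1"
  proof -
    have "transpose k ** k = mat 1" using k assms(1) by (auto simp: orthogonal_matrix)
    then have "(\<Sum>l\<in>UNIV. k $ l $ i * k $ l $ j) = mat 1 $ i $ j" for i j
      by (simp add: vec_eq_iff matrix_matrix_mult_def transpose_def)
    then have "complex_of_real (\<Sum>l\<in>UNIV. k $ l $ i * k $ l $ j) = mat 1 $ i $ j" for i j
      by (simp add: mat_def)
    then show ?thesis
      by (simp add: vec_eq_iff matrix_matrix_mult_def transpose_def)
  qed
  moreover have "transpose g ** g = transpose h **
      (transpose (map_matrix complex_of_real k) ** map_matrix complex_of_real k) ** h"
    unfolding g by (simp only: matrix_transpose_mul matrix_mul_assoc)
  ultimately show ?thesis by simp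
qed

text \<open>Choose the identity in the analytic factor. Invariance under the complexification thus
  gives invariance under \<open>K\<close>.\<close>

lemma map_matrix_in_complexification: "k \<in> K \<Longrightarrow> map_matrix complex_of_real k \<in> complexification K"
  unfolding complexification_def set_mult_def analytic_subgroup_def
  using generate.one[of general_linear] by (force simp: general_linear_def)

lemma bform_orthogonal:
  assumes "transpose g ** g = mat 1"
  shows "bform (g *v \<xi>) (g *v \<eta>) = bform \<xi> \<eta>"
proof -
  have "bform (g *v \<xi>) (g *v \<eta>) = (\<Sum>i\<in>UNIV. \<Sum>j\<in>UNIV. \<Sum>l\<in>UNIV. g $ l $ i * g $ l $ j * (\<xi> $ i * \<eta> $ j))"
    unfolding bform_def matrix_vector_mult_def
    by (simp add: sum_product)
       (subst sum.swap, rule sum.cong[OF refl], subst sum.swap, simp add: mult_ac)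
  also have "\<dots> = (\<Sum>i\<in>UNIV. \<Sum>j\<in>UNIV. (transpose g ** g) $ i $ j * (\<xi> $ i * \<eta> $ j))"
    by (simp add: matrix_matrix_mult_def transpose_def sum_distrib_right)
  also have "\<dots> = bform \<xi> \<eta>"
    by (simp add: assms mat_def bform_def if_distrib[of "\<lambda>x. x * _"] cong: if_cong)
  finally show ?thesis .
qed

section \<open>Polynomial functions\<close>

lemma polynomial_fun_monomial:
  "polynomial_fun (\<lambda>\<xi>::complex^'n. c * (\<Prod>i\<in>UNIV. \<xi> $ i ^ \<alpha> i))"
  unfolding polynomial_fun_def
  by (rule exI[of _ "{\<alpha>}"], rule exI[of _ "\<lambda>_. c"]) simp

lemma polynomial_fun_const: "polynomial_fun (\<lambda>\<xi>::complex^'n. c)"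
  using polynomial_fun_monomial[of c "\<lambda>_. 0"] by simp

lemma polynomial_fun_coord: "polynomial_fun (\<lambda>\<xi>::complex^'n. \<xi> $ i)"
proof -
  have "(\<Prod>j\<in>UNIV. \<xi> $ j ^ (if j = i then 1 else 0)) = \<xi> $ i" for \<xi> :: "complex^'n"
    by (subst prod.remove[of UNIV i]) auto
  then show ?thesis
    using polynomial_fun_monomial[of 1 "\<lambda>j. if j = i then 1 else 0"] by simp
qed

lemma polynomial_fun_add:
  fixes p q :: "complex^'n \<Rightarrow> complex"
  assumes "polynomial_fun p" "polynomial_fun q"
  shows "polynomial_fun (\<lambda>\<xi>. p \<xi> + q \<xi>)"
proof -
  obtain S a T b where S: "finite S" "p = (\<lambda>\<xi>. \<Sum>\<alpha>\<in>S. a \<alpha> * (\<Prod>i\<in>UNIV. \<xi> $ i ^ \<alpha> i))"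
    and T: "finite T" "q = (\<lambda>\<xi>. \<Sum>\<alpha>\<in>T. b \<alpha> * (\<Prod>i\<in>UNIV. \<xi> $ i ^ \<alpha> i))"
    using assms unfolding polynomial_fun_def by blast
  \<comment> \<open>Both coefficient families are extended by zero to the union of the exponent
    sets.\<close>
  let ?c = "\<lambda>\<alpha>. (if \<alpha> \<in> S then a \<alpha> else 0) + (if \<alpha> \<in> T then b \<alpha> else 0)"
  have "p \<xi> + q \<xi> = (\<Sum>\<alpha>\<in>S \<union> T. ?c \<alpha> * (\<Prod>i\<in>UNIV. \<xi> $ i ^ \<alpha> i))" for \<xi>
  proof -
    have "p \<xi> = (\<Sum>\<alpha>\<in>S \<union> T. (if \<alpha> \<in> S then a \<alpha> else 0) * (\<Prod>i\<in>UNIV. \<xi> $ i ^ \<alpha> i))"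
      unfolding S(2) using S(1) T(1) by (intro sum.mono_neutral_cong_left) auto
    moreover have "q \<xi> = (\<Sum>\<alpha>\<in>S \<union> T. (if \<alpha> \<in> T then b \<alpha> else 0) * (\<Prod>i\<in>UNIV. \<xi> $ i ^ \<alpha> i))"
      unfolding T(2) using S(1) T(1) by (intro sum.mono_neutral_cong_left) auto
    ultimately show ?thesis by (simp only: distrib_right sum.distrib)
  qed
  then show ?thesis
    unfolding polynomial_fun_def using S(1) T(1)
    by (intro exI[of _ "S \<union> T"] exI[of _ ?c]) auto
qed

lemma polynomial_fun_sum:
  "finite I \<Longrightarrow> (\<And>i. i \<in> I \<Longrightarrow> polynomial_fun (p i)) \<Longrightarrow> polynomial_fun (\<lambda>\<xi>. \<Sum>i\<in>I. p i \<xi>)"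
  by (induction I rule: finite_induct) (simp_all add: polynomial_fun_const polynomial_fun_add)

lemma polynomial_fun_mult:
  fixes p q :: "complex^'n \<Rightarrow> complex"
  assumes "polynomial_fun p" "polynomial_fun q"
  shows "polynomial_fun (\<lambda>\<xi>. p \<xi> * q \<xi>)"
proof -
  obtain S a T b where S: "finite S" "p = (\<lambda>\<xi>. \<Sum>\<alpha>\<in>S. a \<alpha> * (\<Prod>i\<in>UNIV. \<xi> $ i ^ \<alpha> i))"
    and T: "finite T" "q = (\<lambda>\<xi>. \<Sum>\<beta>\<in>T. b \<beta> * (\<Prod>i\<in>UNIV. \<xi> $ i ^ \<beta> i))"
    using assms unfolding polynomial_fun_def by blast
  \<comment> \<open>Different pairs of exponents may have the same sum, so the product is handled as
    a double sum of monomial functions instead of one sum indexed by distinct exponents.\<close>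
  have "(\<lambda>\<xi>. p \<xi> * q \<xi>) =
      (\<lambda>\<xi>. \<Sum>\<alpha>\<in>S. \<Sum>\<beta>\<in>T. a \<alpha> * b \<beta> * (\<Prod>i\<in>UNIV. \<xi> $ i ^ (\<alpha> i + \<beta> i)))"
    unfolding S(2) T(2) by (simp add: sum_product power_add prod.distrib mult_ac)
  then show ?thesis
    using S(1) T(1) by (simp add: polynomial_fun_sum polynomial_fun_monomial)
qed

lemma polynomial_fun_poly_comp:
  assumes "polynomial_fun p"
  shows "polynomial_fun (\<lambda>\<xi>. poly q (p \<xi>))"
  by (induction q) (simp_all add: polynomial_fun_const polynomial_fun_add polynomial_fun_mult assms)

lemma polynomial_fun_bform: "polynomial_fun (\<lambda>\<xi>. bform \<xi> \<xi>)"
  unfolding bform_def by (intro polynomial_fun_sum polynomial_fun_mult polynomial_fun_coord) simp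

section \<open>Restriction to lines and Zariski density of the real vectors\<close>

lemma polynomial_fun_line:
  fixes p :: "complex^'n \<Rightarrow> complex"
  assumes "polynomial_fun p"
  shows "\<exists>q. \<forall>t. p (u + t *s v) = poly q t"
proof -
  obtain S a where S: "finite S" "p = (\<lambda>\<xi>. \<Sum>\<alpha>\<in>S. a \<alpha> * (\<Prod>i\<in>UNIV. \<xi> $ i ^ \<alpha> i))"
    using assms unfolding polynomial_fun_def by blast
  \<comment> \<open>The witness substitutes the linear polynomial \<open>[:u $ i, v $ i:]\<close>
    for the i-th coordinate.\<close>
  have "p (u + t *s v) =
      poly (\<Sum>\<alpha>\<in>S. smult (a \<alpha>) (\<Prod>i\<in>UNIV. [:u $ i, v $ i:] ^ \<alpha> i)) t" for t
    by (simp add: S(2) poly_sum poly_prod)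
  then show ?thesis by blast
qed

lemma poly_eqI_infinite:
  fixes p q :: "'a::idom poly"
  assumes "infinite T" and "\<And>t. t \<in> T \<Longrightarrow> poly p t = poly q t"
  shows "p = q"
proof (rule ccontr)
  assume "p \<noteq> q"
  then have "finite {t. poly (p - q) t = 0}" by (intro poly_roots_finite) simp
  moreover have "T \<subseteq> {t. poly (p - q) t = 0}" using assms(2) by auto
  ultimately show False using assms(1) finite_subset by blast
qed

definition cvec :: "real^'n \<Rightarrow> complex^'n" where
  "cvec x = (\<chi> i. complex_of_real (x $ i))"

text \<open>Every \<xi> lies on a complex line all of whose real points are real vectors.\<close>

lemma polynomial_fun_eqI_real:
  fixes p q :: "complex^'n \<Rightarrow> complex"
  assumes "polynomial_fun p" "polynomial_fun q" and eq: "\<And>x. p (cvec x) = q (cvec x)"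
  shows "p \<xi> = q \<xi>"
proof -
  let ?x = "\<chi> i. Re (\<xi> $ i)" and ?y = "\<chi> i. Im (\<xi> $ i)"
  obtain P Q where P: "\<And>t. p (cvec ?x + t *s cvec ?y) = poly P t"
    and Q: "\<And>t. q (cvec ?x + t *s cvec ?y) = poly Q t"
    using polynomial_fun_line[OF assms(1)] polynomial_fun_line[OF assms(2)] by metis
  have "poly P t = poly Q t" if t: "t \<in> range complex_of_real" for t
  proof -
    obtain s where "t = complex_of_real s" using t by auto
    then have "cvec ?x + t *s cvec ?y = cvec (?x + s *\<^sub>R ?y)"
      by (simp add: cvec_def vec_eq_iff)
    with eq P Q show ?thesis by metis
  qed
  moreover have "infinite (range complex_of_real)"
    by (simp add: finite_image_iff inj_on_def infinite_UNIV_char_0)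
  ultimately have "P = Q" by (rule poly_eqI_infinite[rotated])
  \<comment> \<open>The given vector is the point t = i of the line, while the two restrictions were
    compared at real t.\<close>
  moreover have "\<xi> = cvec ?x + \<i> *s cvec ?y"
    by (simp add: cvec_def vec_eq_iff complex_eq[symmetric])
  ultimately show ?thesis using P Q by metis
qed

section \<open>Even polynomials in one variable\<close>

lemma poly_even_odd_parts:
  fixes q :: "'a::comm_ring_1 poly"
  shows "\<exists>g h. \<forall>t. poly q t = poly g (t\<^sup>2) + t * poly h (t\<^sup>2)"
proof (induction q)
  case 0
  have "poly 0 t = poly 0 (t\<^sup>2) + t * poly 0 (t\<^sup>2)" for t :: 'a by simp
  then show ?case by blast
next
  case (pCons a q)
  then obtain g h where "\<And>t. poly q t = poly g (t\<^sup>2) + t * poly h (t\<^sup>2)" by blast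
  \<comment> \<open>Multiplication by t interchanges the even and odd parts; the constant
    \<open>a\<close> joins the new even part.\<close>
  then have "poly (pCons a q) t = poly (pCons a h) (t\<^sup>2) + t * poly g (t\<^sup>2)" for t
    by (simp add: algebra_simps power2_eq_square)
  then show ?case by blast
qed

lemma poly_even:
  fixes q :: "'a::field_char_0 poly"
  assumes "\<And>t. poly q (- t) = poly q t"
  obtains h where "\<And>t. poly q t = poly h (t\<^sup>2)"
proof -
  obtain g h where gh: "\<And>t. poly q t = poly g (t\<^sup>2) + t * poly h (t\<^sup>2)"
    using poly_even_odd_parts by blast
  \<comment> \<open>The difference isolates the odd part, which evenness kills because 2 is
    invertible.\<close>
  have "2 * (t * poly h (t\<^sup>2)) = poly q t - poly q (- t)" for t
    by (simp add: gh)
  then have "t * poly h (t\<^sup>2) = 0" for t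
    using assms by simp
  with gh show thesis by (intro that[of g]) simp
qed


section \<open>Invariant polynomials\<close>

lemma bform_cvec: "bform (cvec x) (cvec x) = complex_of_real ((norm x)\<^sup>2)"
proof -
  have "bform (cvec x) (cvec x) = complex_of_real (x \<bullet> x)"
    by (simp add: bform_def cvec_def inner_vec_def)
  then show ?thesis by (simp only: power2_norm_eq_inner)
qed

lemma map_matrix_cvec: "map_matrix complex_of_real k *v cvec x = cvec (k *v x)"
  by (simp add: cvec_def matrix_vector_mult_def vec_eq_iff)

text \<open>Transitivity moves every real vector to a multiple of one unit vector \<open>e\<close>,
  so the restriction \<open>q\<close> of \<open>p\<close> to the line through \<open>e\<close>
  determines \<open>p\<close> on real vectors, and density does the rest.\<close>

lemma invariant_polynomial_factors:
  fixes p :: "complex^'n \<Rightarrow> complex"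
  assumes p: "polynomial_fun p" and trans: "transitive_on_spheres K"
    and inv: "\<And>k \<xi>. k \<in> K \<Longrightarrow> p (map_matrix complex_of_real k *v \<xi>) = p \<xi>"
  obtains h where "p = (\<lambda>\<xi>. poly h (bform \<xi> \<xi>))"
proof -
  have radial: "p (cvec x) = p (cvec y)" if "norm x = norm y" for x y :: "real^'n"
  \<comment> \<open>\<open>transitive_on_spheres\<close> speaks of positive radii, so the zero
    vector is treated apart.\<close>
  proof (cases "x = 0")
    case True
    then show ?thesis using that by simp
  next
    case False
    then have "0 < norm x" "x \<in> sphere 0 (norm x)" "y \<in> sphere 0 (norm x)"
      using that by auto
    then obtain k where "k \<in> K" "k *v x = y"
      using trans unfolding transitive_on_spheres_def by blast
    then show ?thesis using inv[of k "cvec x"] by (simp add: map_matrix_cvec)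
  qed
  \<comment> \<open>Index types are nonempty, so some coordinate axis exists.\<close>
  fix i0 :: 'n
  define e where "e = (axis i0 1 :: real^'n)"
  have e: "norm (s *\<^sub>R e) = \<bar>s\<bar>" for s by (simp add: e_def)
  obtain q where q: "\<And>t. p (0 + t *s cvec e) = poly q t"
    using polynomial_fun_line[OF p] by blast
  have q_real: "poly q (complex_of_real s) = p (cvec (s *\<^sub>R e))" for s
    unfolding q[symmetric] by (rule arg_cong[of _ _ p]) (simp add: cvec_def vec_eq_iff)
  \<comment> \<open>The vectors s e and -s e have equal norm, so \<open>q\<close> is even at real
    arguments. There are infinitely many of these, hence \<open>q\<close> is even as a complex
    polynomial.\<close>
  have "q = pcompose q [:0, -1:]"
  proof (rule poly_eqI_infinite)
    show "infinite (range complex_of_real)"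
      by (simp add: finite_image_iff inj_on_def infinite_UNIV_char_0)
    show "poly q t = poly (pcompose q [:0, -1:]) t" if t: "t \<in> range complex_of_real" for t
    proof -
      obtain s where s: "t = complex_of_real s" using t by auto
      have "poly q (complex_of_real s) = poly q (complex_of_real (- s))"
        unfolding q_real by (rule radial) (simp only: e abs_minus_cancel)
      then show ?thesis by (simp add: s poly_pcompose)
    qed
  qed
  then have "poly q (- t) = poly q t" for t
    by (metis poly_pcompose poly_pCons poly_0 mult_zero_right add_0 add_0_right mult_minus1_right)
  then obtain h where h: "\<And>t. poly q t = poly h (t\<^sup>2)" by (rule poly_even) blast
  have "p \<xi> = poly h (bform \<xi> \<xi>)" for \<xi>
  proof (rule polynomial_fun_eqI_real[OF p polynomial_fun_poly_comp[OF polynomial_fun_bform]])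
    fix x :: "real^'n"
    \<comment> \<open>On the line through \<open>e\<close> the value at \<open>norm x\<close> is
      \<open>h\<close> at the squared norm, and that square is b(x,x).\<close>
    have "p (cvec x) = p (cvec (norm x *\<^sub>R e))" by (rule radial) (simp only: e abs_norm_cancel)
    also have "\<dots> = poly h (bform (cvec x) (cvec x))"
      by (simp add: q_real[symmetric] h bform_cvec)
    finally show "p (cvec x) = poly h (bform (cvec x) (cvec x))" .
  qed
  then show thesis by (intro that) auto
qed

lemma invariant_polynomials_complexification:
  fixes K :: "(real^'n^'n) set"
  assumes K: "K \<subseteq> {A. orthogonal_matrix A}" and trans: "transitive_on_spheres K"
  shows "invariant_polynomials (complexification K) = range (\<lambda>q \<xi>. poly q (bform \<xi> \<xi>))"
proof (intro equalityI subsetI)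
  fix p assume "p \<in> invariant_polynomials (complexification K)"
  then have "polynomial_fun p" "\<And>k \<xi>. k \<in> K \<Longrightarrow> p (map_matrix complex_of_real k *v \<xi>) = p \<xi>"
    using map_matrix_in_complexification by (auto simp: invariant_polynomials_def)
  from this(1) trans this(2) obtain h where "p = (\<lambda>\<xi>. poly h (bform \<xi> \<xi>))"
    by (rule invariant_polynomial_factors)
  then show "p \<in> range (\<lambda>q \<xi>. poly q (bform \<xi> \<xi>))" by blast
next
  fix p :: "complex^'n \<Rightarrow> complex"
  assume "p \<in> range (\<lambda>q \<xi>. poly q (bform \<xi> \<xi>))"
  then show "p \<in> invariant_polynomials (complexification K)"
    using complexification_orthogonal[OF K]
    by (auto simp: invariant_polynomials_def polynomial_fun_poly_comp polynomial_fun_bform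
        bform_orthogonal)
qed

lemma invariant_rel_bform:
  assumes "invariant_polynomials G = range (\<lambda>q \<xi>. poly q (bform \<xi> \<xi>))"
  shows "invariant_rel G = {(\<xi>, \<eta>). bform \<xi> \<xi> = bform \<eta> \<eta>}"
proof -
  have "bform \<xi> \<xi> = bform \<eta> \<eta>"
    if "\<forall>q. poly q (bform \<xi> \<xi>) = poly q (bform \<eta> \<eta>)" for \<xi> \<eta> :: "complex^'n"
    \<comment> \<open>The identity polynomial already separates distinct values of the form.\<close>
    using that[rule_format, of "[:0, 1:]"] by simp
  then show ?thesis unfolding invariant_rel_def assms by auto
qed


section \<open>Varieties isomorphic to the affine line\<close>

text \<open>The coordinate \<open>\<phi>\<close> identifies \<open>A\<close> with the polynomial
  ring in one variable. It generates the algebra, and a character is evaluation at its value on this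
  generator, which is attained at exactly one point.\<close>

lemma affine_variety_of_bij:
  assumes bij: "bij_betw \<phi> X (UNIV :: complex set)"
    and reg: "A = range (\<lambda>q. \<lambda>x\<in>X. poly q (\<phi> x))"
  shows "affine_variety \<lparr>points = X, regular = A\<rparr>"
  unfolding affine_variety_def space_with_functions.simps
proof (intro conjI allI impI)
  show "A \<subseteq> extensional X" by (auto simp: reg)
next
  have "f \<in> A" if "f \<in> generated_subalgebra X {restrict \<phi> X}" for f
    using that
  proof induction
    case (gen f)
    then have "f = (\<lambda>x\<in>X. poly [:0, 1:] (\<phi> x))" by auto
    then show ?case unfolding reg by blast
  next
    case (const c)
    have "(\<lambda>x\<in>X. c) = (\<lambda>x\<in>X. poly [:c:] (\<phi> x))" by auto
    then show ?case unfolding reg by blast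
  next
    case (add f g)
    then obtain p q where "f = (\<lambda>x\<in>X. poly p (\<phi> x))" "g = (\<lambda>x\<in>X. poly q (\<phi> x))"
      by (auto simp: reg)
    then have "(\<lambda>x\<in>X. f x + g x) = (\<lambda>x\<in>X. poly (p + q) (\<phi> x))" by auto
    then show ?case unfolding reg by blast
  next
    case (mult f g)
    then obtain p q where "f = (\<lambda>x\<in>X. poly p (\<phi> x))" "g = (\<lambda>x\<in>X. poly q (\<phi> x))"
      by (auto simp: reg)
    then have "(\<lambda>x\<in>X. f x * g x) = (\<lambda>x\<in>X. poly (p * q) (\<phi> x))" by auto
    then show ?case unfolding reg by blast
  qed
  moreover have "(\<lambda>x\<in>X. poly q (\<phi> x)) \<in> generated_subalgebra X {restrict \<phi> X}" for q
  proof (induction q)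
    case 0
    then show ?case by (simp only: poly_0 generated_subalgebra.const)
  next
    case (pCons a q)
    \<comment> \<open>A Horner step, with every intermediate function restricted to \<open>X\<close>
      so as to match the closure rules.\<close>
    have "(\<lambda>x\<in>X. poly (pCons a q) (\<phi> x)) =
        (\<lambda>x\<in>X. (\<lambda>x\<in>X. a) x + (\<lambda>x\<in>X. restrict \<phi> X x * (\<lambda>x\<in>X. poly q (\<phi> x)) x) x)"
      by auto
    also have "\<dots> \<in> generated_subalgebra X {restrict \<phi> X}"
      by (intro generated_subalgebra.add generated_subalgebra.const generated_subalgebra.mult
          pCons.IH generated_subalgebra.gen singletonI)
    finally show ?case .
  qed
  moreover have "restrict \<phi> X = (\<lambda>x\<in>X. poly [:0, 1:] (\<phi> x))" by auto
  then have "restrict \<phi> X \<in> A" unfolding reg by blast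
  ultimately show "\<exists>F. finite F \<and> F \<subseteq> A \<and> A = generated_subalgebra X F"
    by (intro exI[of _ "{restrict \<phi> X}"]) (auto simp: reg)
next
  fix \<psi> assume \<psi>: "character_on X A \<psi>"
  let ?r = "\<lambda>q. \<lambda>x\<in>X. poly q (\<phi> x)"
  have const: "\<psi> (\<lambda>x\<in>X. c) = c" for c
    using \<psi> by (simp add: character_on_def)
  have add: "\<psi> (\<lambda>x\<in>X. f x + g x) = \<psi> f + \<psi> g"
    and mult: "\<psi> (\<lambda>x\<in>X. f x * g x) = \<psi> f * \<psi> g" if "f \<in> A" "g \<in> A" for f g
    using \<psi> that unfolding character_on_def by blast+
  have r: "?r q \<in> A" for q unfolding reg by blast
  \<comment> \<open>The image of the generator under the character is the coordinate of the point
    sought.\<close>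
  define z where "z = \<psi> (?r [:0, 1:])"
  have \<psi>_poly: "\<psi> (?r q) = poly q z" for q
  proof (induction q)
    case 0
    then show ?case by (simp only: poly_0 const)
  next
    case (pCons a q)
    have "?r (pCons a q) = (\<lambda>x\<in>X. ?r [:a:] x + ?r ([:0, 1:] * q) x)" by auto
    then have "\<psi> (?r (pCons a q)) = \<psi> (?r [:a:]) + \<psi> (?r ([:0, 1:] * q))"
      by (simp only: add r)
    also have "\<psi> (?r [:a:]) = a" using const[of a] by simp
    also have "?r ([:0, 1:] * q) = (\<lambda>x\<in>X. ?r [:0, 1:] x * ?r q x)" by auto
    also have "\<psi> \<dots> = z * poly q z" by (simp only: mult r pCons.IH z_def)
    finally show ?case by simp
  qed
  obtain x where x: "x \<in> X" "\<phi> x = z"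
    using bij by (metis UNIV_I bij_betw_imp_surj_on imageE)
  show "\<exists>!x. x \<in> X \<and> (\<forall>f\<in>A. \<psi> f = f x)"
  proof (rule ex1I[of _ x])
    show "x \<in> X \<and> (\<forall>f\<in>A. \<psi> f = f x)" using x \<psi>_poly by (auto simp: reg)
    fix y assume y: "y \<in> X \<and> (\<forall>f\<in>A. \<psi> f = f y)"
    \<comment> \<open>Uniqueness follows by testing a second point on the generator alone, as
      \<open>\<phi>\<close> is injective.\<close>
    then have "\<psi> (?r [:0, 1:]) = ?r [:0, 1:] y" using r by blast
    then have "\<phi> y = z" using y by (simp add: z_def)
    then show "y = x" using x y bij by (metis bij_betw_def inj_onD)
  qed
qed

lemma affine_variety_iso_affine_line:
  assumes bij: "bij_betw \<phi> X (UNIV :: complex set)"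
    and reg: "A = range (\<lambda>q. \<lambda>x\<in>X. poly q (\<phi> x))"
  shows "affine_variety_iso \<lparr>points = X, regular = A\<rparr> affine_line \<phi>"
  unfolding affine_variety_iso_def
proof (intro conjI)
  show "affine_variety \<lparr>points = X, regular = A\<rparr>"
    by (rule affine_variety_of_bij[OF bij reg])
  show "affine_variety affine_line"
    \<comment> \<open>The line itself is the case in which the coordinate is the identity.\<close>
    unfolding affine_line_def by (rule affine_variety_of_bij[of "\<lambda>z. z"]) (simp_all add: bij_betw_def restrict_def)
  show "bij_betw \<phi> (points \<lparr>points = X, regular = A\<rparr>) (points affine_line)"
    using bij by (simp add: affine_line_def)
  show "variety_morphism \<lparr>points = X, regular = A\<rparr> affine_line \<phi>"
    by (auto simp: variety_morphism_def affine_line_def reg)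
  have "inv_into X \<phi> z \<in> X" "\<phi> (inv_into X \<phi> z) = z" for z
    using bij by (auto simp: bij_betw_def inv_into_into f_inv_into_f)
  then show "variety_morphism affine_line \<lparr>points = X, regular = A\<rparr>
      (inv_into (points \<lparr>points = X, regular = A\<rparr>) \<phi>)"
    by (auto simp: variety_morphism_def affine_line_def reg restrict_def)
qed

section \<open>The quotient as the space of fibres of the quadratic form\<close>

theorem theorem6p3:
  fixes K :: "(real^'n^'n) set"
  assumes "subgroup K orthogonal_grp"
    and "closed K"
    and "transitive_on_spheres K"
  shows "points (categorical_quotient (complexification K)) = {Q c |c. c \<noteq> 0} \<union> {Q 0 \<union> {0}} \<and>
    (\<exists>\<phi>. affine_variety_iso (categorical_quotient (complexification K)) affine_line \<phi> \<and>
         (\<forall>c. c \<noteq> 0 \<longrightarrow> \<phi> (Q c) = c) \<and> \<phi> (Q 0 \<union> {0}) = 0)"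
proof -
  let ?G = "complexification K"
  have K: "K \<subseteq> {A. orthogonal_matrix A}"
    using subgroup.subset[OF assms(1)] by (simp add: orthogonal_grp_def)
  note inv = invariant_polynomials_complexification[OF K assms(3)]
  note rel = invariant_rel_bform[OF inv]
  \<comment> \<open>Full fibres of the quadratic form treat all values uniformly: \<open>L c\<close>
    is \<open>Q c\<close> for nonzero c, and \<open>L 0\<close> adds the origin to
    \<open>Q 0\<close>.\<close>
  define L :: "complex \<Rightarrow> (complex^'n) set" where "L c = {\<xi>. bform \<xi> \<xi> = c}" for c
  define \<phi> :: "(complex^'n) set \<Rightarrow> complex" where "\<phi> = inv_into UNIV L"
  have cls: "invariant_rel ?G `` {\<xi>} = L (bform \<xi> \<xi>)" for \<xi>
    by (auto simp: rel L_def)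
  have surj: "\<exists>\<xi>::complex^'n. bform \<xi> \<xi> = c" for c
  proof -
    \<comment> \<open>A vector with the single coordinate \<open>csqrt c\<close> on some axis
      realizes the value c.\<close>
    fix i :: 'n
    have "bform (axis i (csqrt c)) (axis i (csqrt c)) = (\<Sum>j\<in>UNIV. if j = i then c else 0)"
      unfolding bform_def
      by (intro sum.cong) (auto simp: axis_def power2_eq_square[symmetric])
    also have "\<dots> = c" by simp
    finally have "bform (axis i (csqrt c)) (axis i (csqrt c)) = c" .
    then show ?thesis by blast
  qed
  have "inj L"
  proof (rule injI)
    fix c d assume eq: "L c = L d"
    obtain \<xi> :: "complex^'n" where "bform \<xi> \<xi> = c" using surj by blast
    with eq show "c = d" by (auto simp: L_def)
  qed
  then have \<phi>: "\<phi> (L c) = c" for c by (simp add: \<phi>_def)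
  have points: "UNIV // invariant_rel ?G = range L"
  proof -
    have "UNIV // invariant_rel ?G = L ` range (\<lambda>\<xi>::complex^'n. bform \<xi> \<xi>)"
      by (auto simp: quotient_def cls)
    also have "range (\<lambda>\<xi>::complex^'n. bform \<xi> \<xi>) = UNIV"
      by (rule surjI[of _ "\<lambda>c. SOME \<xi>. bform \<xi> \<xi> = c"]) (rule someI_ex[OF surj])
    finally show ?thesis .
  qed
  have L_Q: "L c = Q c" if "c \<noteq> 0" for c using that by (simp add: L_def Q_def)
  have L_0: "L 0 = Q 0 \<union> {0}" by (auto simp: L_def Q_def bform_def)
  have "range L = L ` {c. c \<noteq> 0} \<union> {L 0}" by auto
  then have range_L: "range L = {Q c |c. c \<noteq> 0} \<union> {Q 0 \<union> {0}}" using L_Q L_0 by auto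
  have bij: "bij_betw \<phi> (range L) UNIV"
    by (rule bij_betwI[of _ _ _ L]) (auto simp: \<phi>)
  have reg: "{f \<in> extensional (range L). (\<lambda>\<xi>. f (L (bform \<xi> \<xi>))) \<in> invariant_polynomials ?G}
      = range (\<lambda>q. \<lambda>x\<in>range L. poly q (\<phi> x))"
  proof (intro equalityI subsetI)
    fix f assume "f \<in> {f \<in> extensional (range L). (\<lambda>\<xi>. f (L (bform \<xi> \<xi>))) \<in> invariant_polynomials ?G}"
    then obtain q where f: "f \<in> extensional (range L)"
      and feq: "(\<lambda>\<xi>::complex^'n. f (L (bform \<xi> \<xi>))) = (\<lambda>\<xi>. poly q (bform \<xi> \<xi>))"
      unfolding inv by blast
    \<comment> \<open>Surjectivity of the quadratic form turns the identity on vectors into one for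
      every value c, so \<open>f\<close> is determined on all classes.\<close>
    have "f (L c) = poly q c" for c
    proof -
      obtain \<xi> :: "complex^'n" where "bform \<xi> \<xi> = c" using surj by blast
      with fun_cong[OF feq, of \<xi>] show ?thesis by simp
    qed
    then have "f = (\<lambda>x\<in>range L. poly q (\<phi> x))"
      using f by (intro extensionalityI[of _ "range L"]) (auto simp: \<phi>)
    then show "f \<in> range (\<lambda>q. \<lambda>x\<in>range L. poly q (\<phi> x))" by blast
  next
    fix f assume "f \<in> range (\<lambda>q. \<lambda>x\<in>range L. poly q (\<phi> x))"
    then obtain q where f: "f = (\<lambda>x\<in>range L. poly q (\<phi> x))" by blast
    then have "(\<lambda>\<xi>. f (L (bform \<xi> \<xi>))) = (\<lambda>\<xi>::complex^'n. poly q (bform \<xi> \<xi>))"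
      by (simp add: \<phi>)
    then have "(\<lambda>\<xi>. f (L (bform \<xi> \<xi>))) \<in> invariant_polynomials ?G"
      unfolding inv by (rule range_eqI)
    then show "f \<in> {f \<in> extensional (range L). (\<lambda>\<xi>. f (L (bform \<xi> \<xi>))) \<in> invariant_polynomials ?G}"
      using f by simp
  qed
  have quot: "categorical_quotient ?G =
      \<lparr>points = range L, regular = range (\<lambda>q. \<lambda>x\<in>range L. poly q (\<phi> x))\<rparr>"
    unfolding categorical_quotient_def cls points reg ..
  show ?thesis
  proof (intro conjI exI[of _ \<phi>] allI impI)
    show "points (categorical_quotient ?G) = {Q c |c. c \<noteq> 0} \<union> {Q 0 \<union> {0}}"
      by (simp only: quot space_with_functions.simps range_L)
    show "affine_variety_iso (categorical_quotient ?G) affine_line \<phi>"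
      unfolding quot by (rule affine_variety_iso_affine_line[OF bij refl])
    show "\<phi> (Q c) = c" if "c \<noteq> 0" for c
      using \<phi>[of c] by (simp only: L_Q[OF that])
    show "\<phi> (Q 0 \<union> {0}) = 0"
      using \<phi>[of 0] by (simp only: L_0)
  qed
qed

end
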